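(* Let $n\geqslant 5$. For each unordered pair $\{i,j\}$ of distinct elements of $\{1,\dots,n\}$, let $P(i,j)$ be the subgraph of $BS_n$ with vertex set $\{[\pi_1\dots\pi_{n-2}\,i\,j],\ [\pi_1\dots\pi_{n-2}\,j\,i]\}$ (all permutations whose last two entries are $i$ and $j$ in some order) and with the edges of $BS_n$ corresponding to $b_1,\dots,b_{n-3},b_{n-1}$ between these vertices; each $P(i,j)$ is isomorphic to the generalized prism $BS_{n-2}\times K_2$, and the $P(i,j)$ form a maximal cover of $BS_n$. Then $BS_n$ has a Hamiltonian cycle based on this cover, i.e. a Hamiltonian cycle of $BS_n$ in which, for every pair $\{i,j\}$, the vertices of $P(i,j)$ are visited consecutively (so the cycle restricted to each $P(i,j)$ is a Hamiltonian path of $P(i,j)$).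
   Context: $Sym_n$ is the symmetric group of permutations $\pi=[\pi_1\ldots\pi_n]$ of $\{1,\dots,n\}$; $b_i=(i\ i+1)$ for $1\leqslant i\leqslant n-1$, and right multiplication by $b_i$ swaps positions $i$ and $i+1$. The Bubble-sort graph $BS_n=Cay(Sym_n,\{b_1,\dots,b_{n-1}\})$ has $\pi$ adjacent to $\pi b_i$. For a graph $G$, the generalized prism is the Cartesian product $G\times K_2$. A maximal cover of a graph by copies of a subgraph $H$ is a collection of vertex-disjoint subgraphs isomorphic to $H$ such that every vertex lies in one of them. *)

theory Defs
  imports "Graph_Theory.Graph_Theory" "HOL-Algebra.Sym_Groups"
begin

text \<open>
  An undirected simple graph is represented as in \<^theory>\<open>Graph_Theory.Pair_Digraph\<close>, by a
  symmetric loop-free set of vertex pairs (\<^locale>\<open>pair_graph\<close>): the edge between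
  \<open>u\<close> and \<open>v\<close> is the pair of arcs \<open>(u, v)\<close>, \<open>(v, u)\<close>.
\<close>

text \<open>The result is undirected and loop-free when \<open>S\<close> is closed under inverses and omits the unit.\<close>

definition cayley_graph :: "('a, 'b) monoid_scheme \<Rightarrow> 'a set \<Rightarrow> 'a pair_pre_digraph" where
  "cayley_graph G S =
     \<lparr> pverts = carrier G, parcs = {(x, x \<otimes>\<^bsub>G\<^esub> s) | x s. x \<in> carrier G \<and> s \<in> S} \<rparr>"

definition cartesian_product ::
  "'a pair_pre_digraph \<Rightarrow> 'b pair_pre_digraph \<Rightarrow> ('a \<times> 'b) pair_pre_digraph" where
  "cartesian_product G H =
     \<lparr> pverts = pverts G \<times> pverts H,
       parcs = {((u, x), (v, y)) | u x v y.
                  (u = v \<and> u \<in> pverts G \<and> (x, y) \<in> parcs H) \<or>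
                  ((u, v) \<in> parcs G \<and> x = y \<and> x \<in> pverts H)} \<rparr>"

definition K2 :: "bool pair_pre_digraph" where
  "K2 = \<lparr> pverts = UNIV, parcs = {(x, y). x \<noteq> y} \<rparr>"

lemma complete_digraph_K2: "complete_digraph 2 (with_proj K2)"
  by (auto simp: complete_digraph_pair_def K2_def card_UNIV_bool)

definition generalized_prism :: "'a pair_pre_digraph \<Rightarrow> ('a \<times> bool) pair_pre_digraph" where
  "generalized_prism G = cartesian_product G K2"

definition maximal_cover ::
  "'a pair_pre_digraph \<Rightarrow> 'b pair_pre_digraph \<Rightarrow> 'a pair_pre_digraph set \<Rightarrow> bool" where
  "maximal_cover G H C \<longleftrightarrow>
     (\<forall>P\<in>C. subgraph (with_proj P) (with_proj G) \<and> digraph_iso (with_proj P) (with_proj H)) \<and>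
     pairwise (\<lambda>P Q. disjnt (pverts P) (pverts Q)) C \<and>
     (\<Union>P\<in>C. pverts P) = pverts G"

text \<open>
  Paths and cycles are lists of arcs, as for \<^const>\<open>pre_digraph.apath\<close> and
  \<^const>\<open>pre_digraph.cycle\<close>. In a symmetric digraph \<^const>\<open>pre_digraph.cycle\<close> admits
  going back and forth along a single edge, hence the bound on the length.
\<close>

definition hamiltonian_path :: "('a, 'b) pre_digraph \<Rightarrow> 'b awalk \<Rightarrow> bool" where
  "hamiltonian_path G p \<longleftrightarrow>
     (\<exists>u v. pre_digraph.apath G u p v \<and> set (pre_digraph.awalk_verts G u p) = verts G)"

definition hamiltonian_cycle :: "('a, 'b) pre_digraph \<Rightarrow> 'b awalk \<Rightarrow> bool" where
  "hamiltonian_cycle G p \<longleftrightarrow>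
     pre_digraph.cycle G p \<and> 3 \<le> length p \<and> set (map (tail G) p) = verts G"

text \<open>
  A segment of a cyclic sequence of arcs is a prefix of one of its rotations; for each member
  of the cover some segment of the cycle is a Hamiltonian path of that member.
\<close>

definition hamiltonian_cycle_based_on ::
  "'a pair_pre_digraph \<Rightarrow> 'a pair_pre_digraph set \<Rightarrow> ('a \<times> 'a) awalk \<Rightarrow> bool" where
  "hamiltonian_cycle_based_on G C p \<longleftrightarrow>
     hamiltonian_cycle (with_proj G) p \<and>
     (\<forall>P\<in>C. \<exists>k q r. rotate k p = q @ r \<and> hamiltonian_path (with_proj P) q)"

abbreviation bubble_swap :: "nat \<Rightarrow> nat \<Rightarrow> nat" where
  "bubble_swap i \<equiv> transpose i (i + 1)"

text \<open>
  A permutation \<open>p\<close> of \<open>{1..n}\<close> stands for the word \<open>[p 1, ..., p n]\<close>. The product of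
  \<^const>\<open>sym_group\<close> is composition, so \<open>p \<otimes> bubble_swap i = p \<circ> bubble_swap i\<close> is
  \<open>p\<close> with the entries at positions \<open>i\<close> and \<open>i + 1\<close> exchanged.
\<close>

definition bubble_sort_graph :: "nat \<Rightarrow> (nat \<Rightarrow> nat) pair_pre_digraph" where
  "bubble_sort_graph n = cayley_graph (sym_group n) (bubble_swap ` {1..n - 1})"

lemma pair_graph_bubble_sort_graph: "pair_graph (bubble_sort_graph n)"
proof -
  let ?G = "bubble_sort_graph n"
  have arcs: "(p, q) \<in> parcs ?G \<longleftrightarrow>
      p permutes {1..n} \<and> (\<exists>i\<in>{1..n - 1}. q = p \<circ> bubble_swap i)" for p q
    by (auto simp: bubble_sort_graph_def cayley_graph_def sym_group_def)
  have verts: "p \<in> pverts ?G \<longleftrightarrow> p permutes {1..n}" for p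
    by (simp add: bubble_sort_graph_def cayley_graph_def sym_group_def)
  have perm: "p \<circ> bubble_swap i permutes {1..n}"
    if "p permutes {1..n}" "i \<in> {1..n - 1}" for p i
    using that by (intro permutes_compose permutes_swap_id) auto
  have fin: "finite (pverts ?G)"
    using finite_permutations[of "{1..n}"]
    by (simp add: bubble_sort_graph_def cayley_graph_def sym_group_def)
  have sub: "parcs ?G \<subseteq> pverts ?G \<times> pverts ?G"
    using perm by (auto simp: arcs verts)
  have sym: "(q, p) \<in> parcs ?G" if pq: "(p, q) \<in> parcs ?G" for p q
  proof -
    from pq obtain i where i: "i \<in> {1..n - 1}" "p permutes {1..n}" "q = p \<circ> bubble_swap i"
      by (auto simp: arcs)
    from i(3) have "q \<circ> bubble_swap i = p"
      by (simp add: comp_assoc)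
    moreover from i perm have "q permutes {1..n}" by simp
    ultimately show ?thesis using i(1) unfolding arcs by blast
  qed
  have loop: "p \<noteq> q" if "(p, q) \<in> parcs ?G" for p q
  proof
    assume "p = q"
    with that obtain i where "p permutes {1..n}" and eq: "p = p \<circ> bubble_swap i"
      by (auto simp: arcs)
    moreover from eq have "p i = p (i + 1)"
      by (metis comp_apply transpose_apply_first)
    ultimately have "i = i + 1"
      by (blast dest: permutes_inj injD)
    then show False by simp
  qed
  show ?thesis
  proof unfold_locales
    show "finite (parcs ?G)"
      using fin sub by (auto intro: finite_subset)
    show "symmetric (with_proj ?G)"
      using sym by (auto simp: symmetric_def intro: symI)
  qed (use fin sub loop in auto)
qed

text \<open>
  The parameters \<open>i\<close> and \<open>j\<close> enter symmetrically, so this depends only on the unordered pair.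
\<close>

definition bs_prism :: "nat \<Rightarrow> nat \<Rightarrow> nat \<Rightarrow> (nat \<Rightarrow> nat) pair_pre_digraph" where
  "bs_prism n i j =
     (let V = {p \<in> pverts (bubble_sort_graph n).
                 (p (n - 1) = i \<and> p n = j) \<or> (p (n - 1) = j \<and> p n = i)}
      in \<lparr> pverts = V,
           parcs = {(p, q). p \<in> V \<and> q \<in> V \<and>
                      (\<exists>k \<in> {1..n - 3} \<union> {n - 1}. q = p \<otimes>\<^bsub>sym_group n\<^esub> bubble_swap k)} \<rparr>)"

definition bs_prism_cover :: "nat \<Rightarrow> (nat \<Rightarrow> nat) pair_pre_digraph set" where
  "bs_prism_cover n = {bs_prism n i j | i j. i \<in> {1..n} \<and> j \<in> {1..n} \<and> i \<noteq> j}"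

end

theory Submission
  imports Defs
begin

text \<open>
  Call a vertex set laceable when any two of its vertices of opposite parity are the ends of a
  Hamiltonian path of it. The prism on permutations with a fixed pair of last entries is laceable:
  freeze also the entries at positions \<open>k + 1, \<dots>, n - 2\<close> and induct on \<open>k\<close>. Splitting by the entry
  at position \<open>k + 1\<close> gives smaller blocks, any two of which are joined by edges (swaps at
  position \<open>k\<close>) in both parities. If the two ends lie in different blocks, run through the
  blocks one after the other; every block is entered with the parity of the start and left with the
  opposite one. If they lie in the same block, take a Hamiltonian path of that block, cut an edge of
  it whose ends differ at position \<open>k\<close>, and insert a path through all other blocks there.

  The prisms themselves are linked in the same way whenever their pairs share one letter, so the
  cyclic order \<open>{1,n}, {1,n-1}, \<dots>, {1,2}, {2,n}, \<dots>, {2,3}, \<dots>, {n-1,n}\<close> of the pairs yields the cycle.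
\<close>

section \<open>Hamiltonian paths as vertex lists, and their concatenation over laceable
  blocks\<close>

definition hpath :: "('a \<Rightarrow> 'a \<Rightarrow> bool) \<Rightarrow> 'a set \<Rightarrow> 'a list \<Rightarrow> bool" where
  "hpath R B xs \<longleftrightarrow> xs \<noteq> [] \<and> distinct xs \<and> set xs = B \<and> successively R xs"

text \<open>Hamilton-laceability with respect to a 2-colouring \<open>c\<close>, which is later the
  parity \<open>evenperm\<close>.\<close>

definition laceable :: "('a \<Rightarrow> 'a \<Rightarrow> bool) \<Rightarrow> ('a \<Rightarrow> bool) \<Rightarrow> 'a set \<Rightarrow> bool" where
  "laceable R c B \<longleftrightarrow>
     (\<forall>u\<in>B. \<forall>v\<in>B. c u \<noteq> c v \<longrightarrow> (\<exists>xs. hpath R B xs \<and> hd xs = u \<and> last xs = v))"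

text \<open>Both values of \<open>b\<close> are demanded so that a path can leave \<open>B\<close>
  towards \<open>B'\<close> at a vertex of whichever colour laceability forces on its end.\<close>

definition linked :: "('a \<Rightarrow> 'a \<Rightarrow> bool) \<Rightarrow> ('a \<Rightarrow> bool) \<Rightarrow> 'a set \<Rightarrow> 'a set \<Rightarrow> bool" where
  "linked R c B B' \<longleftrightarrow> (\<forall>b. \<exists>x\<in>B. \<exists>y\<in>B'. c x = b \<and> c y \<noteq> b \<and> R x y)"

lemma hpath_append:
  assumes "hpath R B xs" "hpath R C ys" "disjnt B C" "R (last xs) (hd ys)"
  shows "hpath R (B \<union> C) (xs @ ys)"
  using assms by (auto simp: hpath_def disjnt_def successively_append_iff)

lemma hpath_mono:
  assumes "hpath R B xs" "\<And>x y. R x y \<Longrightarrow> R' x y"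
  shows "hpath R' B xs"
  using assms by (auto simp: hpath_def intro: successively_mono)

lemma hpath_insert_detour:
  assumes xs: "hpath R B (xs @ ys)" "xs \<noteq> []" "ys \<noteq> []"
    and ws: "hpath R C ws" and "disjnt B C"
    and "R (last xs) (hd ws)" "R (last ws) (hd ys)"
  shows "hpath R (B \<union> C) (xs @ ws @ ys)"
  using assms by (auto simp: hpath_def disjnt_def successively_append_iff)

text \<open>Each block is entered at the colour of \<open>u\<close> and left at the other colour, so
  laceability applies in every block and the last one can end in \<open>v\<close>. Edges inside
  blocks come from \<open>R\<close>, edges between blocks from the larger \<open>R'\<close>. The
  pieces \<open>xss\<close> are kept apart because the cycle must later exhibit a Hamiltonian path
  of each prism.\<close>

lemma laceable_chain:
  assumes "Bs \<noteq> []" "\<And>B. B \<in> set Bs \<Longrightarrow> laceable R c B" "sorted_wrt disjnt Bs"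
    and "successively (linked R' c) Bs" and mono: "\<And>x y. R x y \<Longrightarrow> R' x y"
    and "u \<in> hd Bs" "v \<in> last Bs" "c u \<noteq> c v"
  shows "\<exists>xss. list_all2 (hpath R) Bs xss \<and> hpath R' (\<Union>(set Bs)) (concat xss) \<and>
    hd (concat xss) = u \<and> last (concat xss) = v"
  using assms(1-4,6-8)
proof (induction Bs arbitrary: u rule: list_nonempty_induct)
  case (single B)
  then obtain xs where "hpath R B xs" "hd xs = u" "last xs = v"
    by (auto simp: laceable_def)
  then show ?case
    using hpath_mono[OF _ mono] by (intro exI[of _ "[xs]"]) auto
next
  case (cons B Bs)
  have "linked R' c B (hd Bs)"
    using cons.prems(3) cons.hyps by (auto simp: successively_Cons)
  \<comment> \<open>The exit \<open>x\<close> has the colour opposite to \<open>u\<close>; the entry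
    \<open>y\<close> has the colour of \<open>u\<close> again, so the induction hypothesis applies
    with \<open>y\<close> for \<open>u\<close>.\<close>
  then obtain x y where xy: "x \<in> B" "y \<in> hd Bs" "c x \<noteq> c u" "c y = c u" "R' x y"
    unfolding linked_def by metis
  obtain xs where xs: "hpath R B xs" "hd xs = u" "last xs = x"
    using cons.prems(1)[of B] cons.prems(4) xy unfolding laceable_def by fastforce
  obtain xss where xss: "list_all2 (hpath R) Bs xss" "hpath R' (\<Union>(set Bs)) (concat xss)"
    "hd (concat xss) = y" "last (concat xss) = v"
    using cons.IH[of y] cons.prems cons.hyps xy by (auto simp: successively_Cons)
  have "hpath R' (B \<union> \<Union>(set Bs)) (xs @ concat xss)"
    using cons.prems(2) xs xss xy hpath_mono[OF xs(1) mono]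
    by (intro hpath_append) (auto simp: disjnt_def)
  moreover have "hd (xs @ concat xss) = u" "last (xs @ concat xss) = v"
    using xs xss by (auto simp: hpath_def)
  ultimately show ?case
    using xs xss by (intro exI[of _ "xs # xss"]) auto
qed

text \<open>Supplies the order in which blocks are traversed. Equal ends are possible only for a
  one-element list, hence the alternative \<open>A = {a}\<close>.\<close>

lemma exists_distinct_list_ends:
  assumes "finite A" "a \<in> A" "b \<in> A" "a \<noteq> b \<or> A = {a}"
  shows "\<exists>xs. xs \<noteq> [] \<and> distinct xs \<and> set xs = A \<and> hd xs = a \<and> last xs = b"
proof (cases "a = b")
  case True
  then show ?thesis using assms by (intro exI[of _ "[a]"]) auto
next
  case False
  obtain ys where "set ys = A - {a, b}" "distinct ys"
    using assms(1) finite_distinct_list[of "A - {a, b}"] by auto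
  then show ?thesis using assms False by (intro exI[of _ "a # ys @ [b]"]) auto
qed

text \<open>Used in contrapositive form, together with \<open>not_successivelyE\<close>, to find the
  edge to cut: a list on which \<open>f\<close> takes two values has neighbours with different
  values.\<close>

lemma successively_eq_imp_eq:
  assumes "successively (\<lambda>x y. f x = f y) xs" "x \<in> set xs" "y \<in> set xs"
  shows "f x = f y"
proof -
  have "f z = f (hd xs)" if "z \<in> set xs" for z
    using assms(1) that by (induction xs) (auto simp: successively_Cons split: if_splits)
  then show ?thesis using assms by metis
qed

lemma not_successivelyE:
  assumes "\<not> successively P xs"
  obtains ys x y zs where "xs = ys @ x # y # zs" "\<not> P x y"
proof -
  have "\<exists>ys x y zs. xs = ys @ x # y # zs \<and> \<not> P x y"
    using assms
  proof (induction xs rule: induct_list012)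
    case (3 x y zs)
    show ?case
    proof (cases "P x y")
      case True
      then obtain ys x' y' zs' where "y # zs = ys @ x' # y' # zs'" "\<not> P x' y'"
        using 3 by auto
      then show ?thesis by (intro exI[of _ "x # ys"]) auto
    next
      case False
      then show ?thesis by (intro exI[of _ "[]"]) auto
    qed
  qed auto
  then show ?thesis using that by blast
qed

text \<open>This makes parity a proper 2-colouring of the Bubble-sort graph.\<close>

lemma evenperm_comp_transpose:
  assumes "permutation p" "a \<noteq> b"
  shows "evenperm (p \<circ> transpose a b) \<longleftrightarrow> \<not> evenperm p"
  using assms by (simp add: evenperm_comp permutation_swap_id evenperm_swap)

section \<open>Laceability of the blocks\<close>

text \<open>The flag \<open>e\<close> tells whether the last two positions are exchanged; it becomes
  the \<open>K2\<close> coordinate of the prism.\<close>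

definition twist :: "nat \<Rightarrow> bool \<Rightarrow> nat \<Rightarrow> nat" where
  "twist n e = (if e then bubble_swap (n - 1) else id)"

text \<open>
  For \<open>k < n - 1\<close> this is the left coset of \<open>p\<close> under the group generated by the swaps at positions
  \<open>1, \<dots>, k - 1\<close> and \<open>n - 1\<close>.
\<close>

definition bs_block :: "nat \<Rightarrow> nat \<Rightarrow> (nat \<Rightarrow> nat) \<Rightarrow> (nat \<Rightarrow> nat) set" where
  "bs_block n k p = {p \<circ> s \<circ> twist n e | s e. s permutes {1..k}}"

text \<open>One relation for all levels: \<open>k = n - 2\<close> gives the edges of the prisms, and
  \<open>k = n\<close> those of the whole graph, since position \<open>n - 1\<close> is then already
  among \<open>1, ..., n - 1\<close>.\<close>

definition bstep :: "nat \<Rightarrow> nat \<Rightarrow> (nat \<Rightarrow> nat) \<Rightarrow> (nat \<Rightarrow> nat) \<Rightarrow> bool" where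
  "bstep n k p q \<longleftrightarrow> (\<exists>i \<in> {1..<k} \<union> {n - 1}. q = p \<circ> bubble_swap i)"

lemma twist_apply: "i < n - 1 \<Longrightarrow> twist n e i = i"
  by (auto simp: twist_def transpose_def)

lemma twist_comp: "twist n e \<circ> twist n e' = twist n (e \<noteq> e')"
  by (auto simp: twist_def)

text \<open>The supports are disjoint: \<open>s\<close> moves only positions up to \<open>k\<close>,
  the twist only \<open>n - 1\<close> and \<open>n\<close>.\<close>

lemma twist_comm:
  assumes "s permutes {1..k}" "k < n - 1"
  shows "twist n e \<circ> s = s \<circ> twist n e"
proof
  fix i
  show "(twist n e \<circ> s) i = (s \<circ> twist n e) i"
  proof (cases "i \<in> {1..k}")
    case True
    then have "s i \<in> {1..k}" using permutes_in_image[OF assms(1)] by simp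
    then show ?thesis using True assms(2) by (simp add: twist_apply)
  next
    case False
    then have "s i = i" "twist n e i \<notin> {1..k}"
      using assms by (auto simp: permutes_not_in twist_def transpose_def)
    then show ?thesis using assms(1) by (simp add: permutes_not_in)
  qed
qed

lemma permutation_twist: "permutation (twist n e)"
  by (simp add: twist_def permutation_swap_id)

lemma permutation_bs_block:
  assumes "permutation p" "q \<in> bs_block n k p"
  shows "permutation q"
proof -
  obtain s e where q: "q = p \<circ> s \<circ> twist n e" "s permutes {1..k}"
    using assms(2) by (auto simp: bs_block_def)
  have "permutation s" using q(2) by (rule permutes_imp_permutation[rotated]) simp
  then show ?thesis
    unfolding q(1) using assms(1) by (intro permutation_compose permutation_twist)
qed

lemma self_in_bs_block: "p \<in> bs_block n k p"
  unfolding bs_block_def by (auto simp: twist_def intro!: exI[of _ id] exI[of _ False])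

lemma bs_block_comp:
  assumes "q \<in> bs_block n k p" "t permutes {1..k}" "k < n - 1"
  shows "q \<circ> t \<circ> twist n e \<in> bs_block n k p"
proof -
  obtain s e' where q: "q = p \<circ> s \<circ> twist n e'" "s permutes {1..k}"
    using assms(1) by (auto simp: bs_block_def)
  have "q \<circ> t \<circ> twist n e = p \<circ> s \<circ> (twist n e' \<circ> t) \<circ> twist n e"
    by (simp add: q comp_assoc)
  also have "\<dots> = p \<circ> (s \<circ> t) \<circ> (twist n e' \<circ> twist n e)"
    unfolding twist_comm[OF assms(2,3)] by (simp only: comp_assoc)
  finally show ?thesis
    using permutes_compose[OF assms(2) q(2)] unfolding bs_block_def twist_comp by blast
qed

lemma bs_block_comp_transpose:
  assumes "q \<in> bs_block n k p" "i \<in> {1..k}" "j \<in> {1..k}" "k < n - 1"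
  shows "q \<circ> transpose i j \<in> bs_block n k p"
  using bs_block_comp[OF assms(1) permutes_swap_id[OF assms(2,3)] assms(4), of False]
  by (simp add: twist_def)

lemma bs_block_apply:
  assumes "permutation p" "q \<in> bs_block n k p" "k < n - 1" "i \<in> {1..k}"
  shows "q i \<in> p ` {1..k}"
  using assms permutes_in_image unfolding bs_block_def by (fastforce simp: twist_apply)

text \<open>The splitting behind the induction. If \<open>q\<close> and \<open>r\<close> arise from
  \<open>p\<close> through \<open>s\<close> and \<open>t\<close> and agree at position
  \<open>Suc k\<close>, then \<open>s\<close> and \<open>t\<close> agree there, so the inverse of
  \<open>s\<close> followed after \<open>t\<close> fixes \<open>Suc k\<close> and permutes
  \<open>{1..k}\<close>; the twists commute past it.\<close>

lemma bs_block_same: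
  assumes p: "permutation p" and q: "q \<in> bs_block n (Suc k) p" and k: "Suc k < n - 1"
  shows "{r \<in> bs_block n (Suc k) p. r (Suc k) = q (Suc k)} = bs_block n k q"
proof (intro equalityI subsetI)
  fix r assume r: "r \<in> {r \<in> bs_block n (Suc k) p. r (Suc k) = q (Suc k)}"
  obtain s e where s: "q = p \<circ> s \<circ> twist n e" "s permutes {1..Suc k}"
    using q by (auto simp: bs_block_def)
  obtain t e' where t: "r = p \<circ> t \<circ> twist n e'" "t permutes {1..Suc k}"
    using r by (auto simp: bs_block_def)
  have "p (s (Suc k)) = p (t (Suc k))"
    using r s t k by (simp add: twist_apply)
  then have st: "s (Suc k) = t (Suc k)"
    using p by (metis permutation_permutes permutes_inj injD)
  define h where "h = Hilbert_Choice.inv s \<circ> t"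
  have h': "h permutes {1..Suc k}"
    unfolding h_def using s t by (intro permutes_compose permutes_inv)
  have "h permutes {1..k}"
  proof (rule permutes_superset[OF h'])
    fix x assume "x \<in> {1..Suc k} - {1..k}"
    then have "x = Suc k" by auto
    then show "h x = x" by (simp add: h_def permutes_inverses[OF s(2)] flip: st)
  qed
  moreover have "q \<circ> h \<circ> twist n (e \<noteq> e') = r"
  proof -
    have "q \<circ> h \<circ> twist n (e \<noteq> e') = p \<circ> s \<circ> (twist n e \<circ> h) \<circ> twist n (e \<noteq> e')"
      by (simp add: s comp_assoc)
    also have "\<dots> = p \<circ> (s \<circ> h) \<circ> (twist n e \<circ> twist n (e \<noteq> e'))"
      unfolding twist_comm[OF h' k] by (simp only: comp_assoc)
    also have "s \<circ> h = t"
      unfolding h_def by (simp add: permutes_inv_o[OF s(2)] flip: comp_assoc)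
    also have "twist n e \<circ> twist n (e \<noteq> e') = twist n e'"
      by (cases e; cases e') (auto simp: twist_def)
    finally show ?thesis by (simp only: t)
  qed
  ultimately show "r \<in> bs_block n k q" unfolding bs_block_def by blast
next
  fix r assume "r \<in> bs_block n k q"
  then obtain s e where r: "r = q \<circ> s \<circ> twist n e" "s permutes {1..k}"
    by (auto simp: bs_block_def)
  have "s permutes {1..Suc k}" by (rule permutes_subset[OF r(2)]) auto
  moreover have "s (Suc k) = Suc k" using r(2) by (simp add: permutes_not_in)
  ultimately show "r \<in> {r \<in> bs_block n (Suc k) p. r (Suc k) = q (Suc k)}"
    using bs_block_comp[OF q _ k] r k by (simp add: twist_apply)
qed

lemma bstep_mono: "bstep n k p q \<Longrightarrow> k \<le> l \<Longrightarrow> bstep n l p q"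
  by (auto simp: bstep_def)

text \<open>The block consists of \<open>p\<close> and its twist only, joined by the swap at
  position \<open>n - 1\<close>.\<close>

lemma laceable_bs_block_1:
  assumes "permutation p"
  shows "laceable (bstep n 1) evenperm (bs_block n 1 p)"
  unfolding laceable_def
proof (intro ballI impI)
  have C: "bs_block n 1 p = {p, p \<circ> bubble_swap (n - 1)}"
    by (auto simp: bs_block_def twist_def)
  fix u v assume uv: "u \<in> bs_block n 1 p" "v \<in> bs_block n 1 p" "evenperm u \<noteq> evenperm v"
  then have "u = p \<and> v = p \<circ> bubble_swap (n - 1) \<or> v = p \<and> u = p \<circ> bubble_swap (n - 1)"
    unfolding C by auto
  then show "\<exists>xs. hpath (bstep n 1) (bs_block n 1 p) xs \<and> hd xs = u \<and> last xs = v"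
    using uv(3) unfolding C
    by (intro exI[of _ "[u, v]"]) (auto simp: hpath_def bstep_def comp_assoc)
qed

lemma laceable_bs_block_Suc:
  assumes p: "permutation p" and k: "1 \<le> k" "Suc k < n - 1"
    and IH: "\<And>q. permutation q \<Longrightarrow> laceable (bstep n k) evenperm (bs_block n k q)"
  shows "laceable (bstep n (Suc k)) evenperm (bs_block n (Suc k) p)"
proof -
  define C where "C = bs_block n (Suc k) p"
  \<comment> \<open>\<open>A\<close> is the common set of letters that members of \<open>C\<close>
    carry at positions \<open>1, ..., Suc k\<close>; the sub-blocks \<open>S x\<close> are indexed
    by it.\<close>
  define A where "A = p ` {1..Suc k}"
  define S where "S x = {q \<in> C. q (Suc k) = x}" for x
  have perm: "permutation q" if "q \<in> C" for q
    using permutation_bs_block[OF p] that by (simp add: C_def)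
  have inj: "inj q" if "q \<in> C" for q
    using perm[OF that] by (metis permutation_permutes permutes_inj)
  have letter: "q i \<in> A" if "q \<in> C" "i \<in> {1..Suc k}" for q i
    using bs_block_apply[OF p _ k(2)] that by (simp add: C_def A_def)
  have closed: "q \<circ> transpose i j \<in> C" if "q \<in> C" "i \<in> {1..Suc k}" "j \<in> {1..Suc k}" for q i j
    using bs_block_comp_transpose[OF _ that(2,3) k(2)] that(1) by (simp add: C_def)
  have closed': "q \<circ> bubble_swap (n - 1) \<in> C" if "q \<in> C" for q
    using bs_block_comp[OF that[unfolded C_def] permutes_id k(2), of True] by (simp add: C_def twist_def)
  have letters: "q ` {1..Suc k} = A" if "q \<in> C" for q
  proof (rule card_subset_eq)
    show "finite A" by (simp add: A_def)
    show "q ` {1..Suc k} \<subseteq> A" using letter[OF that] by blast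
    have "inj p" using p by (metis permutation_permutes permutes_inj)
    then show "card (q ` {1..Suc k}) = card A"
      using inj[OF that] by (simp add: A_def card_image inj_on_subset)
  qed
  have S_eq: "S x = bs_block n k q" if "q \<in> S x" for q x
    using bs_block_same[OF p _ k(2), of q] that by (auto simp: S_def C_def)
  have lac: "laceable (bstep n k) evenperm (S x)" for x
  proof (cases "S x = {}")
    case False
    then obtain q where "q \<in> S x" by blast
    then show ?thesis using IH[of q] S_eq[of q x] perm by (simp add: S_def)
  qed (simp add: laceable_def)
  \<comment> \<open>Two transpositions bring \<open>x\<close> to position \<open>Suc k\<close> and
    then \<open>y\<close> to position \<open>k\<close>. If the parity is wrong, the swap at
    \<open>n - 1\<close> corrects it without touching positions up to \<open>Suc k\<close>; this
    works even when very few positions are free.\<close>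
  have rep: "\<exists>q\<in>S x. q k = y \<and> evenperm q = b" if xy: "x \<in> A" "y \<in> A" "x \<noteq> y" for x y b
  proof -
    have pC: "p \<in> C" by (simp add: C_def self_in_bs_block)
    obtain i where i: "i \<in> {1..Suc k}" "p i = x" using xy(1) unfolding A_def by blast
    define q where "q = p \<circ> transpose i (Suc k)"
    have q: "q \<in> C" "q (Suc k) = x" using closed[OF pC i(1)] i by (auto simp: q_def)
    obtain j where j: "j \<in> {1..Suc k}" "q j = y" using xy(2) letters[OF q(1)] by auto
    have "j \<noteq> Suc k" using j q xy(3) by auto
    define r where "r = q \<circ> transpose j k"
    have r: "r \<in> C" "r k = y" "r (Suc k) = x"
      using closed[OF q(1) j(1), of k] j q \<open>j \<noteq> Suc k\<close> k by (auto simp: r_def transpose_def)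
    define r' where "r' = r \<circ> bubble_swap (n - 1)"
    have "evenperm r' \<noteq> evenperm r"
      unfolding r'_def using evenperm_comp_transpose[OF perm[OF r(1)], of "n - 1" "n - 1 + 1"] by simp
    moreover have "r' \<in> C" "r' k = y" "r' (Suc k) = x"
      using closed'[OF r(1)] r k by (auto simp: r'_def transpose_def)
    ultimately show ?thesis
      using r by (cases "evenperm r = b") (auto simp: S_def)
  qed
  \<comment> \<open>The swap at position \<open>k\<close> moves the letter \<open>q k\<close> to
    position \<open>Suc k\<close>, hence leads into the sub-block named by that letter.\<close>
  have swap: "q \<circ> bubble_swap k \<in> S (q k)" "evenperm (q \<circ> bubble_swap k) \<noteq> evenperm q"
    "bstep n (Suc k) q (q \<circ> bubble_swap k)" "bstep n (Suc k) (q \<circ> bubble_swap k) q"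
    if "q \<in> C" for q
    using closed[OF that, of k "Suc k"] k evenperm_comp_transpose[OF perm[OF that], of k "k + 1"]
    by (auto simp: S_def bstep_def comp_assoc intro!: bexI[of _ k])
  have linked: "linked (bstep n (Suc k)) evenperm (S x) (S y)"
    if xy: "x \<in> A" "y \<in> A" "x \<noteq> y" for x y
    unfolding linked_def
  proof
    fix b
    obtain q where q: "q \<in> S x" "q k = y" "evenperm q = b" using rep[OF xy] by blast
    then have "q \<in> C" by (simp add: S_def)
    from swap[OF this] q
    show "\<exists>q\<in>S x. \<exists>r\<in>S y. evenperm q = b \<and> evenperm r \<noteq> b \<and> bstep n (Suc k) q r" by blast
  qed
  \<comment> \<open>Stated for any list of distinct letters, since it serves both for all of
    \<open>A\<close> and for the detour through \<open>A - {x}\<close>. Any two distinct sub-blocks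
    are linked, so the order is free.\<close>
  have chain: "\<exists>xs. hpath (bstep n (Suc k)) (\<Union>x\<in>set L. S x) xs \<and> hd xs = u \<and> last xs = v"
    if "L \<noteq> []" "distinct L" "set L \<subseteq> A" "u \<in> S (hd L)" "v \<in> S (last L)" "evenperm u \<noteq> evenperm v"
    for L u v
  proof -
    have "sorted_wrt disjnt (map S L)"
      using that(2) by (induction L) (auto simp: S_def disjnt_def)
    moreover have "sorted_wrt (linked (bstep n (Suc k)) evenperm) (map S L)"
      using that(2,3) linked by (induction L) auto
    then have "successively (linked (bstep n (Suc k)) evenperm) (map S L)"
      by (rule successively_if_sorted_wrt)
    ultimately show ?thesis
      using laceable_chain[of "map S L" "bstep n k" evenperm "bstep n (Suc k)" u v] lac that
      by (auto simp: hd_map last_map bstep_mono)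
  qed
  have cover: "(\<Union>x\<in>A. S x) = C"
    using letter by (auto simp: S_def)
  show ?thesis
    unfolding laceable_def C_def[symmetric]
  proof (intro ballI impI)
    fix u v assume uv: "u \<in> C" "v \<in> C" "evenperm u \<noteq> evenperm v"
    define x where "x = u (Suc k)"
    have xA: "x \<in> A" using letter[OF uv(1), of "Suc k"] by (simp add: x_def)
    have uS: "u \<in> S x" using uv by (simp add: S_def x_def)
    show "\<exists>xs. hpath (bstep n (Suc k)) C xs \<and> hd xs = u \<and> last xs = v"
    proof (cases "v (Suc k) = x")
      case False
      obtain L where "L \<noteq> []" "distinct L" "set L = A" "hd L = x" "last L = v (Suc k)"
        using exists_distinct_list_ends[of A x "v (Suc k)"] False xA letter[OF uv(2), of "Suc k"]
        by (auto simp: A_def)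
      then show ?thesis using chain[of L u v] uv uS cover by (simp add: S_def)
    next
      case True
      then have "v \<in> S x" using uv by (simp add: S_def)
      then obtain xs where xs: "hpath (bstep n k) (S x) xs" "hd xs = u" "last xs = v"
        using lac[of x] uS uv(3) unfolding laceable_def by blast
      \<comment> \<open>For \<open>k = 1\<close> there is only one other block, so the detour may start and end in the same one.\<close>
      have "\<exists>ys a b zs. xs = ys @ a # b # zs \<and> (a k \<noteq> b k \<or> A - {x} = {a k})"
      proof (cases "k = 1")
        case True
        \<comment> \<open>The first edge can be cut. It exists because \<open>u\<close> and
          \<open>v\<close> differ in parity, so \<open>xs\<close> has at least two elements.\<close>
        have "xs = u # hd (tl xs) # tl (tl xs)"
          using xs uv(3) by (cases xs; cases "tl xs") (auto simp: hpath_def)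
        moreover have "A - {x} = {u k}"
        proof -
          have "{1..Suc k} = {k, Suc k}" using True by auto
          then have "A = {u k, x}" using letters[OF uv(1)] by (simp add: x_def)
          moreover have "u k \<noteq> x" by (simp add: x_def inj_eq[OF inj[OF uv(1)]])
          ultimately show ?thesis by auto
        qed
        ultimately show ?thesis by (intro exI[of _ "[]"]) auto
      next
        case False
        \<comment> \<open>For \<open>k \<ge> 2\<close> two further letters besides \<open>x\<close>
          are available. By \<open>rep\<close> each of them occurs at position \<open>k\<close>
          inside \<open>S x\<close>, so the entry at \<open>k\<close> must change along
          \<open>xs\<close>.\<close>
        have "\<exists>y z. y \<in> A \<and> z \<in> A \<and> x \<noteq> y \<and> x \<noteq> z \<and> y \<noteq> z"
        proof -
          have "k \<in> {1..Suc k}" "k - 1 \<in> {1..Suc k}"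
            using k False unfolding atLeastAtMost_iff by linarith+
          then have "u k \<in> A" "u (k - 1) \<in> A" using letter[OF uv(1)] by blast+
          moreover have "u k \<noteq> x" "u (k - 1) \<noteq> x" "u k \<noteq> u (k - 1)"
            using k False by (simp_all add: x_def inj_eq[OF inj[OF uv(1)]])
          ultimately show ?thesis by blast
        qed
        then obtain y z q r where "q \<in> S x" "q k = y" "r \<in> S x" "r k = z" "y \<noteq> z"
          using rep[OF xA, of _ True] by metis
        then have "\<not> successively (\<lambda>q r. q k = r k) xs"
          using successively_eq_imp_eq[of "\<lambda>q. q k" xs q r] xs by (auto simp: hpath_def)
        then show ?thesis by (elim not_successivelyE) auto
      qed
      then obtain ys a b zs where ab: "xs = ys @ a # b # zs" "a k \<noteq> b k \<or> A - {x} = {a k}"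
        by blast
      have abS: "a \<in> S x" "b \<in> S x" using xs ab by (auto simp: hpath_def)
      then have abC: "a \<in> C" "b \<in> C" by (auto simp: S_def)
      have other: "q k \<in> A - {x}" if "q \<in> S x" for q
        using that letter[of q k] k inj_eq[OF inj, of q k "Suc k"] by (auto simp: S_def)
      \<comment> \<open>The swaps at \<open>k\<close> lead from \<open>a\<close> into
        \<open>S (a k)\<close> and from \<open>b\<close> into \<open>S (b k)\<close>, which
        prescribes the first and last block of the detour.\<close>
      obtain L where L: "L \<noteq> []" "distinct L" "set L = A - {x}" "hd L = a k" "last L = b k"
        using exists_distinct_list_ends[of "A - {x}" "a k" "b k"] ab(2) other abS
        by (auto simp: A_def)
      have "bstep n k a b"
        using xs(1) ab(1) by (auto simp: hpath_def successively_append_iff)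
      \<comment> \<open>Neighbours have opposite parity, and the swap at \<open>k\<close> flips
        both, so the ends of the detour have the opposite parity that \<open>chain\<close>
        requires.\<close>
      then have "evenperm a \<noteq> evenperm b"
        using evenperm_comp_transpose[OF perm[OF abC(1)]] by (auto simp: bstep_def)
      then have "evenperm (a \<circ> bubble_swap k) \<noteq> evenperm (b \<circ> bubble_swap k)"
        using swap(2)[OF abC(1)] swap(2)[OF abC(2)] by blast
      then obtain ws where ws: "hpath (bstep n (Suc k)) (\<Union>y\<in>A - {x}. S y) ws"
        "hd ws = a \<circ> bubble_swap k" "last ws = b \<circ> bubble_swap k"
        using chain[of L "a \<circ> bubble_swap k" "b \<circ> bubble_swap k"] L swap(1) abC by auto
      have "hpath (bstep n (Suc k)) (S x \<union> (\<Union>y\<in>A - {x}. S y)) ((ys @ [a]) @ ws @ b # zs)"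
      proof (rule hpath_insert_detour)
        show "hpath (bstep n (Suc k)) (S x) ((ys @ [a]) @ b # zs)"
          using hpath_mono[OF xs(1), of "bstep n (Suc k)"] ab(1) by (auto simp: bstep_mono)
        show "disjnt (S x) (\<Union>y\<in>A - {x}. S y)" by (auto simp: disjnt_def S_def)
      qed (use ws swap abC in auto)
      moreover have "S x \<union> (\<Union>y\<in>A - {x}. S y) = C" using cover xA by blast
      moreover have "hd ((ys @ [a]) @ ws @ b # zs) = u" "last ((ys @ [a]) @ ws @ b # zs) = v"
        using xs ab(1) by (auto simp: hd_append)
      ultimately show ?thesis by metis
    qed
  qed
qed

lemma laceable_bs_block:
  assumes "1 \<le> k" "k < n - 1" "permutation p"
  shows "laceable (bstep n k) evenperm (bs_block n k p)"
  using assms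
proof (induction k arbitrary: p rule: nat_induct_at_least)
  case base
  show ?case by (rule laceable_bs_block_1[OF base(2)])
next
  case (Suc k)
  then show ?case by (intro laceable_bs_block_Suc) auto
qed

section \<open>From vertex lists to arc walks\<close>

lemma vwalk_arcs_split: "vwalk_arcs (xs @ y # zs) = vwalk_arcs (xs @ [y]) @ vwalk_arcs (y # zs)"
  by (induction xs rule: induct_list012) auto

lemma map_fst_vwalk_arcs: "map fst (vwalk_arcs (xs @ [y])) = xs"
  by (induction xs rule: induct_list012) auto

lemma awalk_vwalk_arcs:
  fixes G :: "'a pair_pre_digraph"
  assumes "xs \<noteq> []" "set xs \<subseteq> pverts G" "successively (\<lambda>x y. (x, y) \<in> parcs G) xs"
  shows "pre_digraph.awalk (with_proj G) (hd xs) (vwalk_arcs xs) (last xs)" (is ?walk)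
    and "pre_digraph.awalk_verts (with_proj G) (hd xs) (vwalk_arcs xs) = xs" (is ?verts)
proof -
  have "?walk \<and> ?verts"
    using assms unfolding pre_digraph.awalk_def
    by (induction xs rule: induct_list012)
      (simp_all add: cas_with_proj_eq awalk_verts_with_proj_eq del: vwalk_arcs_Cons)
  then show ?walk ?verts by auto
qed

lemma hamiltonian_path_vwalk_arcs:
  assumes "hpath (\<lambda>x y. (x, y) \<in> parcs G) (pverts G) xs"
  shows "hamiltonian_path (with_proj G) (vwalk_arcs xs)"
  using assms awalk_vwalk_arcs[of xs G]
  unfolding hamiltonian_path_def pre_digraph.apath_def hpath_def
  by (intro exI[of _ "hd xs"] exI[of _ "last xs"]) auto

lemma hamiltonian_cycle_vwalk_arcs:
  assumes "hpath (\<lambda>x y. (x, y) \<in> parcs G) (pverts G) xs" "(last xs, hd xs) \<in> parcs G" "3 \<le> length xs"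
  shows "hamiltonian_cycle (with_proj G) (vwalk_arcs (xs @ [hd xs]))"
proof -
  let ?p = "vwalk_arcs (xs @ [hd xs])"
  have xs: "xs \<noteq> []" "distinct xs" "set xs = pverts G" "successively (\<lambda>x y. (x, y) \<in> parcs G) xs"
    using assms(1) unfolding hpath_def by blast+
  have walk: "set (xs @ [hd xs]) \<subseteq> pverts G"
    "successively (\<lambda>x y. (x, y) \<in> parcs G) (xs @ [hd xs])"
    using hd_in_set[OF xs(1)] xs assms(2) by (simp_all add: successively_append_iff)
  have "hd (xs @ [hd xs]) = hd xs" using xs(1) by simp
  then have "pre_digraph.awalk (with_proj G) (hd xs) ?p (hd xs)"
    "pre_digraph.awalk_verts (with_proj G) (hd xs) ?p = xs @ [hd xs]"
    using awalk_vwalk_arcs[OF _ walk] by simp_all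
  \<comment> \<open>The head is repeated at the end to close the walk, so distinctness can be asked
    only of the tail of the vertex list.\<close>
  moreover have "distinct (tl (xs @ [hd xs]))"
    using xs(1,2) by (cases xs) auto
  moreover have len: "length ?p = length xs"
    using map_fst_vwalk_arcs[of xs "hd xs"] by (metis length_map)
  then have "?p \<noteq> []" using xs(1) by auto
  ultimately have "pre_digraph.cycle (with_proj G) ?p"
    unfolding pre_digraph.cycle_def by metis
  then show ?thesis
    using assms(3) unfolding hamiltonian_cycle_def with_proj_simps map_fst_vwalk_arcs len xs(3)
    by blast
qed

text \<open>A member of \<open>xss\<close> occupies a contiguous stretch of the closed walk, and
  rotating the walk to the start of that stretch turns its arcs into a prefix.\<close>

lemma hamiltonian_cycle_based_on_concat:
  assumes "hpath (\<lambda>x y. (x, y) \<in> parcs G) (pverts G) (concat xss)"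
    and "(last (concat xss), hd (concat xss)) \<in> parcs G" "3 \<le> length (concat xss)"
    and cover: "\<And>P. P \<in> C \<Longrightarrow> \<exists>xs\<in>set xss. hpath (\<lambda>x y. (x, y) \<in> parcs P) (pverts P) xs"
  shows "hamiltonian_cycle_based_on G C (vwalk_arcs (concat xss @ [hd (concat xss)]))"
  unfolding hamiltonian_cycle_based_on_def
proof (intro conjI ballI hamiltonian_cycle_vwalk_arcs assms(1-3))
  let ?h = "hd (concat xss)"
  fix P assume "P \<in> C"
  then obtain xs where xs: "xs \<in> set xss" "hpath (\<lambda>x y. (x, y) \<in> parcs P) (pverts P) xs"
    using cover by blast
  then obtain as bs where split: "concat xss = as @ xs @ bs"
    by (metis concat.simps(2) concat_append split_list)
  obtain x xs' where x: "xs = x # xs'" using xs(2) by (cases xs) (auto simp: hpath_def)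
  \<comment> \<open>The cut is at the vertex \<open>x\<close>: the arc entering it belongs to the
    first part, and the second part begins with the arcs of \<open>xs\<close>.\<close>
  have "vwalk_arcs (concat xss @ [?h]) = vwalk_arcs (as @ [x]) @ vwalk_arcs (xs @ bs @ [?h])"
    unfolding split using vwalk_arcs_split[of as x "xs' @ bs @ [?h]"] by (simp add: x split)
  moreover obtain r where "vwalk_arcs (xs @ bs @ [?h]) = vwalk_arcs xs @ r"
    using vwalk_arcs_append[of xs "bs @ [?h]"] x by auto
  ultimately have "rotate (length (vwalk_arcs (as @ [x]))) (vwalk_arcs (concat xss @ [?h]))
      = vwalk_arcs xs @ r @ vwalk_arcs (as @ [x])"
    by (simp only: rotate_append append_assoc)
  then show "\<exists>k q r. rotate k (vwalk_arcs (concat xss @ [?h])) = q @ r \<and> hamiltonian_path (with_proj P) q"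
    using hamiltonian_path_vwalk_arcs[OF xs(2)] by blast
qed

text \<open>Bridges from the bare relation \<open>bstep\<close>, which ignores vertex sets, to the
  arcs of a graph, which also record that both ends are vertices.\<close>

lemma hpath_restrict:
  assumes "hpath R B xs"
  shows "hpath (\<lambda>x y. x \<in> B \<and> y \<in> B \<and> R x y) B xs"
proof -
  have "successively R xs" "set xs = B" using assms by (simp_all only: hpath_def)
  then have "successively (\<lambda>x y. x \<in> B \<and> y \<in> B \<and> R x y) xs"
    by (elim successively_mono) blast
  then show ?thesis using assms unfolding hpath_def by blast
qed

text \<open>Arcs are pairs of vertices, so the vertex map \<open>f\<close> induces the arc map
  \<open>map_prod f f\<close>.\<close>

lemma pair_digraph_isoI:
  assumes wf: "wf_digraph (with_proj G)" "wf_digraph (with_proj H)"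
    and inj: "inj_on f (pverts G)" and verts: "pverts H = f ` pverts G"
    and arcs: "\<And>x y. x \<in> pverts G \<Longrightarrow> y \<in> pverts G \<Longrightarrow> (f x, f y) \<in> parcs H \<longleftrightarrow> (x, y) \<in> parcs G"
  shows "digraph_iso (with_proj G) (with_proj H)"
proof -
  define h where "h = \<lparr> iso_verts = f, iso_arcs = map_prod f f, iso_head = snd, iso_tail = fst \<rparr>"
  have sub: "parcs G \<subseteq> pverts G \<times> pverts G" "parcs H \<subseteq> pverts H \<times> pverts H"
    using wf by (auto simp: wf_digraph_def)
  have "inj_on (map_prod f f) (parcs G)"
    using map_prod_inj_on[OF inj inj] sub(1) inj_on_subset by blast
  then have "pre_digraph.digraph_isomorphism (with_proj G) h"
    using wf(1) inj by (auto simp: pre_digraph.digraph_isomorphism_def h_def)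
  moreover have "parcs H = map_prod f f ` parcs G"
  proof
    show "parcs H \<subseteq> map_prod f f ` parcs G"
    proof
      fix e assume e: "e \<in> parcs H"
      then obtain x y where "x \<in> pverts G" "y \<in> pverts G" "e = (f x, f y)"
        using sub(2) verts by auto
      then show "e \<in> map_prod f f ` parcs G" using arcs e by force
    qed
    show "map_prod f f ` parcs G \<subseteq> parcs H" using arcs sub(1) by auto
  qed
  then have "with_proj H = app_iso h (with_proj G)"
    using verts by (simp add: app_iso_def h_def with_proj_def)
  ultimately show ?thesis unfolding digraph_iso_def by blast
qed

lemma digraph_iso_commute:
  assumes "wf_digraph G" "digraph_iso G H"
  shows "digraph_iso H G"
proof -
  obtain h where h: "pre_digraph.digraph_isomorphism G h" "H = app_iso h G"
    using assms(2) by (auto simp: digraph_iso_def)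
  have "pre_digraph.digraph_isomorphism H (pre_digraph.inv_iso G h)"
    "G = app_iso (pre_digraph.inv_iso G h) H"
    using wf_digraph.digraph_isomorphism_invI[OF assms(1) h(1)] pre_digraph.app_iso_inv[OF h(1)]
    by (simp_all add: h(2))
  then show ?thesis unfolding digraph_iso_def by blast
qed

section \<open>The prisms\<close>

lemma pverts_bubble_sort_graph: "pverts (bubble_sort_graph n) = {p. p permutes {1..n}}"
  by (simp add: bubble_sort_graph_def cayley_graph_def sym_group_def)

lemma parcs_bubble_sort_graph:
  "(p, q) \<in> parcs (bubble_sort_graph n) \<longleftrightarrow>
     p permutes {1..n} \<and> (\<exists>i\<in>{1..n - 1}. q = p \<circ> bubble_swap i)"
  by (auto simp: bubble_sort_graph_def cayley_graph_def sym_group_def)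

lemma parcs_bubble_sort_graph_bstep:
  "2 \<le> n \<Longrightarrow> (p, q) \<in> parcs (bubble_sort_graph n) \<longleftrightarrow> p permutes {1..n} \<and> bstep n n p q"
proof -
  assume "2 \<le> n"
  then have "{1..n - 1} = {1..<n} \<union> {n - 1}" by auto
  then show ?thesis by (simp only: parcs_bubble_sort_graph bstep_def)
qed

lemma pverts_bs_prism:
  "pverts (bs_prism n i j) =
     {p. p permutes {1..n} \<and> ((p (n - 1) = i \<and> p n = j) \<or> (p (n - 1) = j \<and> p n = i))}"
  by (simp add: bs_prism_def Let_def pverts_bubble_sort_graph)

lemma parcs_bs_prism:
  assumes "3 \<le> n"
  shows "(p, q) \<in> parcs (bs_prism n i j) \<longleftrightarrow>
    p \<in> pverts (bs_prism n i j) \<and> q \<in> pverts (bs_prism n i j) \<and> bstep n (n - 2) p q"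
proof -
  have "{1..n - 3} = {1..<n - 2}" using assms by auto
  then show ?thesis by (simp add: bs_prism_def Let_def bstep_def sym_group_mult)
qed

lemma bs_prism_commute: "bs_prism n i j = bs_prism n j i"
  by (simp add: bs_prism_def disj_commute)

lemma permutes_twist: "2 \<le> n \<Longrightarrow> twist n e permutes {1..n}"
  by (auto simp: twist_def intro!: permutes_swap_id)

lemma permutes_two_less:
  fixes n :: nat
  assumes "p permutes {1..n}" "q permutes {1..n}" "q (n - 1) = p (n - 1)" "q n = p n"
  shows "Hilbert_Choice.inv p \<circ> q permutes {1..n - 2}"
proof (rule permutes_superset)
  show "Hilbert_Choice.inv p \<circ> q permutes {1..n}"
    using assms by (intro permutes_compose permutes_inv)
  fix x assume "x \<in> {1..n} - {1..n - 2}"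
  then have "x = n - 1 \<or> x = n" by auto
  then show "(Hilbert_Choice.inv p \<circ> q) x = x"
    using assms(3,4) permutes_inverses[OF assms(1)] by auto
qed

text \<open>Identifies the prisms with the top-level blocks, so that laceability of blocks carries
  over. After a possible twist the last two entries of \<open>q\<close> stand in the order of
  \<open>p\<close>, and the remaining difference permutes \<open>{1..n - 2}\<close>.\<close>

lemma pverts_bs_prism_eq_block:
  assumes n: "2 \<le> n" and p: "p permutes {1..n}"
  shows "pverts (bs_prism n (p (n - 1)) (p n)) = bs_block n (n - 2) p"
proof (intro equalityI subsetI)
  fix q assume q: "q \<in> pverts (bs_prism n (p (n - 1)) (p n))"
  then have qp: "q permutes {1..n}" by (simp add: pverts_bs_prism)
  obtain e where e: "(q \<circ> twist n e) (n - 1) = p (n - 1)" "(q \<circ> twist n e) n = p n"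
  proof (cases "q (n - 1) = p (n - 1) \<and> q n = p n")
    case True
    then show ?thesis using that[of False] by (simp add: twist_def)
  next
    case False
    then have "q (n - 1) = p n" "q n = p (n - 1)" using q by (auto simp: pverts_bs_prism)
    then show ?thesis using that[of True] n by (simp add: twist_def transpose_def)
  qed
  define s where "s = Hilbert_Choice.inv p \<circ> (q \<circ> twist n e)"
  have "s permutes {1..n - 2}"
    unfolding s_def using e qp n p by (intro permutes_two_less permutes_compose permutes_twist)
  \<comment> \<open>The second twist cancels the first, as it is an involution.\<close>
  moreover have "q = p \<circ> s \<circ> twist n e"
    by (simp add: s_def fun_eq_iff permutes_inverses[OF p]) (simp add: twist_def)
  ultimately show "q \<in> bs_block n (n - 2) p" by (auto simp: bs_block_def)
next
  fix q assume "q \<in> bs_block n (n - 2) p"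
  then obtain s e where q: "q = p \<circ> s \<circ> twist n e" "s permutes {1..n - 2}"
    by (auto simp: bs_block_def)
  have "s (n - 1) = n - 1" "s n = n" using n by (auto intro!: permutes_not_in[OF q(2)])
  moreover have "s permutes {1..n}" by (rule permutes_subset[OF q(2)]) auto
  then have "q permutes {1..n}"
    unfolding q(1) using n p by (intro permutes_compose permutes_twist)
  ultimately show "q \<in> pverts (bs_prism n (p (n - 1)) (p n))"
    using n by (cases e) (auto simp: pverts_bs_prism q(1) twist_def transpose_def)
qed

text \<open>Exchange position \<open>i\<close> with the position of \<open>y\<close>; no other entry
  changes, so entries can be prescribed one after another.\<close>

lemma permutes_update:
  assumes "p permutes S" "i \<in> S" "y \<in> S"
  shows "\<exists>q. q permutes S \<and> q i = y \<and> (\<forall>m. m \<noteq> i \<and> p m \<noteq> y \<longrightarrow> q m = p m)"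
proof -
  obtain j where j: "j \<in> S" "p j = y"
    using assms(3) permutes_image[OF assms(1)] by (metis imageE)
  have "p \<circ> transpose i j permutes S"
    using assms(1,2) j(1) by (intro permutes_compose permutes_swap_id)
  moreover have "(p \<circ> transpose i j) i = y" using j(2) by simp
  moreover have "(p \<circ> transpose i j) m = p m" if "m \<noteq> i" "p m \<noteq> y" for m
    using that j(2) by (auto simp: transpose_def)
  ultimately show ?thesis by blast
qed

lemma exists_permutes_two:
  fixes n :: nat
  assumes "i \<in> {1..n}" "j \<in> {1..n}" "i \<noteq> j"
  shows "\<exists>p. p permutes {1..n} \<and> p (n - 1) = i \<and> p n = j"
proof -
  have n: "n - 1 \<in> {1..n}" "n \<in> {1..n}" "n - 1 \<noteq> n" using assms by auto
  obtain p where p: "p permutes {1..n}" "p n = j"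
    using permutes_update[OF permutes_id n(2) assms(2)] by blast
  obtain q where "q permutes {1..n}" "q (n - 1) = i" "q n = j"
    using permutes_update[OF p(1) n(1) assms(1)] p(2) n(3) assms(3) by metis
  then show ?thesis by blast
qed

lemma exists_permutes_three:
  fixes n :: nat
  assumes "3 \<le> n" "i \<in> {1..n}" "j \<in> {1..n}" "k \<in> {1..n}" "i \<noteq> j" "i \<noteq> k" "j \<noteq> k"
  shows "\<exists>p. p permutes {1..n} \<and> p (n - 2) = i \<and> p (n - 1) = j \<and> p n = k"
proof -
  obtain p where p: "p permutes {1..n}" "p (n - 1) = j" "p n = k"
    using exists_permutes_two[of j n k] assms by blast
  have n: "n - 2 \<in> {1..n}" "n - 1 \<noteq> n - 2" "n \<noteq> n - 2" using assms(1) by auto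
  obtain q where "q permutes {1..n}" "q (n - 2) = i" "q (n - 1) = j" "q n = k"
    using permutes_update[OF p(1) n(1) assms(2)] p n assms by metis
  then show ?thesis by blast
qed

lemma wf_bubble_sort_graph: "wf_digraph (with_proj (bubble_sort_graph n))"
proof -
  interpret pair_graph "bubble_sort_graph n" by (rule pair_graph_bubble_sort_graph)
  show ?thesis by unfold_locales
qed

lemma wf_bs_prism: "3 \<le> n \<Longrightarrow> wf_digraph (with_proj (bs_prism n i j))"
  by (auto simp: wf_digraph_def parcs_bs_prism)

lemma wf_generalized_prism:
  "wf_digraph (with_proj G) \<Longrightarrow> wf_digraph (with_proj (generalized_prism G))"
  by (auto simp: wf_digraph_def generalized_prism_def cartesian_product_def K2_def)

text \<open>Fix one member \<open>p\<close> of the prism and send \<open>(s, e)\<close> to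
  \<open>p\<close> followed on the right by \<open>s\<close> and the twist. Swaps at positions below
  \<open>n - 2\<close> then act on \<open>s\<close> alone, and the swap at \<open>n - 1\<close>
  flips \<open>e\<close>.\<close>

lemma bs_prism_iso:
  assumes n: "5 \<le> n" and ij: "i \<in> {1..n}" "j \<in> {1..n}" "i \<noteq> j"
  shows "digraph_iso (with_proj (bs_prism n i j))
    (with_proj (generalized_prism (bubble_sort_graph (n - 2))))"
proof -
  let ?G = "generalized_prism (bubble_sort_graph (n - 2))" and ?H = "bs_prism n i j"
  obtain p where p: "p permutes {1..n}" "p (n - 1) = i" "p n = j"
    using exists_permutes_two[OF ij] by blast
  define f where "f = (\<lambda>(s, e). p \<circ> s \<circ> twist n e)"
  have verts: "pverts ?G = {s. s permutes {1..n - 2}} \<times> UNIV"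
    by (simp add: generalized_prism_def cartesian_product_def K2_def pverts_bubble_sort_graph)
  have arcs: "((s, e), (s', e')) \<in> parcs ?G \<longleftrightarrow> s permutes {1..n - 2} \<and>
      (s = s' \<and> e' = (\<not> e) \<or> (\<exists>k\<in>{1..<n - 2}. s' = s \<circ> bubble_swap k) \<and> e = e')" for s e s' e'
  proof -
    have "{1..n - 2 - 1} = {1..<n - 2}" using n by auto
    then show ?thesis
      by (auto simp: generalized_prism_def cartesian_product_def K2_def
          parcs_bubble_sort_graph pverts_bubble_sort_graph)
  qed
  have H: "pverts ?H = f ` pverts ?G"
    using pverts_bs_prism_eq_block[of n p] p n by (auto simp: verts f_def bs_block_def)
  have inj: "inj_on f (pverts ?G)"
  proof (rule inj_onI, clarsimp simp: verts f_def)
    fix s e s' e'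
    assume s: "s permutes {Suc 0..n - 2}" "s' permutes {Suc 0..n - 2}"
      and "p \<circ> s \<circ> twist n e = p \<circ> s' \<circ> twist n e'"
    then have eq: "s (twist n e x) = s' (twist n e' x)" for x
      using permutes_inj[OF p(1)] by (auto simp: fun_eq_iff inj_eq)
    have fixed: "s n = n" "s' n = n" "s (n - 1) = n - 1" "s' (n - 1) = n - 1"
      using s n by (auto intro!: permutes_not_in[of _ "{Suc 0..n - 2}"])
    \<comment> \<open>Both \<open>s\<close> and \<open>s'\<close> fix \<open>n - 1\<close> and
      \<open>n\<close>, so the value at \<open>n\<close> reveals whether the twist is
      present.\<close>
    have "e = e'"
      using eq[of n] fixed n by (cases e; cases e') (auto simp: twist_def transpose_def)
    moreover have "s x = s' x" for x
      using eq[of "twist n e x"] \<open>e = e'\<close> by (cases e) (simp_all add: twist_def)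
    ultimately show "s = s' \<and> e = e'" by auto
  qed
  have move: "f (s, e) \<circ> bubble_swap k = f (s \<circ> bubble_swap k, e)" if "k \<in> {1..<n - 2}" for s e k
  proof -
    have "bubble_swap k permutes {1..n - 2}" using that by (intro permutes_swap_id) auto
    then have "twist n e \<circ> bubble_swap k = bubble_swap k \<circ> twist n e"
      using n by (intro twist_comm) auto
    then show ?thesis by (simp add: f_def comp_assoc)
  qed
  have flip: "f (s, e) \<circ> bubble_swap (n - 1) = f (s, \<not> e)" for s e
    by (cases e) (simp_all add: f_def twist_def comp_assoc)
  have f_eq: "f (s, e) = f (s', e') \<longleftrightarrow> s = s' \<and> e = e'"
    if "s permutes {1..n - 2}" "s' permutes {1..n - 2}" for s e s' e'
    using inj_on_eq_iff[OF inj, of "(s, e)" "(s', e')"] that by (simp add: verts)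
  have "digraph_iso (with_proj ?G) (with_proj ?H)"
  proof (rule pair_digraph_isoI[OF _ _ inj H])
    show "wf_digraph (with_proj ?G)" by (intro wf_generalized_prism wf_bubble_sort_graph)
    show "wf_digraph (with_proj ?H)" using n by (simp add: wf_bs_prism)
    fix x y assume xy: "x \<in> pverts ?G" "y \<in> pverts ?G"
    obtain s e s' e' where eq: "x = (s, e)" "y = (s', e')" by (cases x; cases y)
    have s: "s permutes {1..n - 2}" "s' permutes {1..n - 2}" using xy eq by (simp_all add: verts)
    have sk: "s \<circ> bubble_swap k permutes {1..n - 2}" if "k \<in> {1..<n - 2}" for k
      using that s by (intro permutes_compose permutes_swap_id) auto
    have "(f x, f y) \<in> parcs ?H \<longleftrightarrow> bstep n (n - 2) (f x) (f y)"
      using xy n H by (simp add: parcs_bs_prism)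
    also have "\<dots> \<longleftrightarrow> (\<exists>k\<in>{1..<n - 2}. f (s', e') = f (s \<circ> bubble_swap k, e)) \<or> f (s', e') = f (s, \<not> e)"
      unfolding bstep_def eq using move flip by (auto simp del: One_nat_def)
    also have "\<dots> \<longleftrightarrow> (\<exists>k\<in>{1..<n - 2}. s' = s \<circ> bubble_swap k \<and> e' = e) \<or> s' = s \<and> e' = (\<not> e)"
      by (intro arg_cong2[where f = "(\<or>)"] bex_cong refl f_eq s sk)
    also have "\<dots> \<longleftrightarrow> (x, y) \<in> parcs ?G"
      unfolding arcs eq using s by auto
    finally show "(f x, f y) \<in> parcs ?H \<longleftrightarrow> (x, y) \<in> parcs ?G" .
  qed
  \<comment> \<open>The explicit map goes from the product to the prism, so the isomorphism is
    reversed.\<close>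
  then show ?thesis
    by (rule digraph_iso_commute[OF wf_generalized_prism[OF wf_bubble_sort_graph]])
qed

section \<open>The Hamiltonian cycle\<close>

text \<open>\<open>e \<noteq> f\<close> compares ordered pairs; for pairs with increasing components
  this is the same as being different unordered pairs.\<close>

definition adjacent_pairs :: "nat \<times> nat \<Rightarrow> nat \<times> nat \<Rightarrow> bool" where
  "adjacent_pairs e f \<longleftrightarrow> e \<noteq> f \<and> {fst e, snd e} \<inter> {fst f, snd f} \<noteq> {}"

text \<open>Downward induction on \<open>a\<close>: the row \<open>(a, n), ..., (a, a + 1)\<close>
  is put before the list for \<open>Suc a\<close>. Pairs in a row share \<open>a\<close>. With
  \<open>a = 1\<close> the two ends of the list share \<open>n\<close>, which closes the
  cycle.\<close>

lemma exists_pair_list: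
  fixes a n :: nat
  assumes "a < n"
  shows "\<exists>L. L \<noteq> [] \<and> distinct L \<and> set L = {(i, j). a \<le> i \<and> i < j \<and> j \<le> n} \<and>
    successively adjacent_pairs L \<and> hd L = (a, n) \<and> last L = (n - 1, n)"
proof -
  have "a \<le> n - 1" using assms by simp
  then show ?thesis
  proof (induction rule: inc_induct)
    case base
    show ?case using assms by (intro exI[of _ "[(n - 1, n)]"]) auto
  next
    case (step a)
    then obtain L where L: "L \<noteq> []" "distinct L" "set L = {(i, j). Suc a \<le> i \<and> i < j \<and> j \<le> n}"
      "successively adjacent_pairs L" "hd L = (Suc a, n)" "last L = (n - 1, n)"
      by blast
    have a: "a < n" "Suc a < n" using step.hyps by auto
    \<comment> \<open>The descending order makes the row end in \<open>(a, Suc a)\<close>, which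
      shares \<open>Suc a\<close> with the head \<open>(Suc a, n)\<close> of
      \<open>L\<close>.\<close>
    define js where "js = rev [Suc a..<Suc n]"
    have js: "distinct js" "set js = {Suc a..n}" "js \<noteq> []" "hd js = n" "last js = Suc a"
      using a by (auto simp: js_def last_rev hd_rev)
    have "sorted_wrt adjacent_pairs (map (Pair a) js)"
      using js(1) by (induction js) (auto simp: adjacent_pairs_def)
    then have "successively adjacent_pairs (map (Pair a) js)"
      by (rule successively_if_sorted_wrt)
    moreover have "adjacent_pairs (last (map (Pair a) js)) (hd L)"
      using L(5) js(3,5) by (simp add: last_map adjacent_pairs_def)
    ultimately have "successively adjacent_pairs (map (Pair a) js @ L)"
      using L(4) by (simp add: successively_append_iff)
    moreover have "set (map (Pair a) js @ L) = {(i, j). a \<le> i \<and> i < j \<and> j \<le> n}"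
    proof (rule Set.set_eqI)
      fix e :: "nat \<times> nat"
      obtain i j where "e = (i, j)" by (cases e)
      then show "e \<in> set (map (Pair a) js @ L) \<longleftrightarrow> e \<in> {(i, j). a \<le> i \<and> i < j \<and> j \<le> n}"
        using a by (cases "i = a") (auto simp: L(3) js(2) image_iff)
    qed
    moreover have "distinct (map (Pair a) js @ L)"
      using L(2,3) js(1) by (auto simp: distinct_map inj_on_def)
    ultimately show ?case
      using L js by (intro exI[of _ "map (Pair a) js @ L"]) (simp_all add: hd_map)
  qed
qed

text \<open>Place the shared letter \<open>c\<close> last. The swap at \<open>n - 2\<close> turns an
  ending \<open>y x c\<close> into \<open>x y c\<close> and so passes from the pair
  \<open>{x, c}\<close> to \<open>{y, c}\<close>.\<close>

lemma linked_bs_prism: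
  assumes n: "5 \<le> n" and ij: "i \<in> {1..n}" "j \<in> {1..n}" "i \<noteq> j"
    and kl: "k \<in> {1..n}" "l \<in> {1..n}" "k \<noteq> l"
    and share: "{i, j} \<noteq> {k, l}" "{i, j} \<inter> {k, l} \<noteq> {}"
  shows "linked (bstep n n) evenperm (pverts (bs_prism n i j)) (pverts (bs_prism n k l))"
  unfolding linked_def
proof
  fix b
  have "\<exists>x y c. x \<in> {1..n} \<and> y \<in> {1..n} \<and> c \<in> {1..n} \<and> x \<noteq> y \<and> x \<noteq> c \<and> y \<noteq> c \<and>
      {i, j} = {x, c} \<and> {k, l} = {y, c}"
  proof -
    consider "i = k" | "i = l" | "j = k" | "j = l" using share(2) by blast
    then show ?thesis
    proof cases
      case 1
      then show ?thesis using ij kl share(1) by (intro exI[of _ j] exI[of _ l] exI[of _ i]) auto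
    next
      case 2
      then show ?thesis using ij kl share(1) by (intro exI[of _ j] exI[of _ k] exI[of _ i]) auto
    next
      case 3
      then show ?thesis using ij kl share(1) by (intro exI[of _ i] exI[of _ l] exI[of _ j]) auto
    next
      case 4
      then show ?thesis using ij kl share(1) by (intro exI[of _ i] exI[of _ k] exI[of _ j]) auto
    qed
  qed
  then obtain x y c where xyc: "x \<in> {1..n}" "y \<in> {1..n}" "c \<in> {1..n}" "y \<noteq> x" "y \<noteq> c" "x \<noteq> c"
    and eq: "{i, j} = {x, c}" "{k, l} = {y, c}" by metis
  obtain p where p: "p permutes {1..n}" "p (n - 2) = y" "p (n - 1) = x" "p n = c"
    using exists_permutes_three[OF _ xyc(2,1,3-6)] n by auto
  \<comment> \<open>Exchanging positions 1 and 2 adjusts the parity; \<open>n \<ge> 5\<close> keeps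
    them away from the last three positions.\<close>
  define q where "q = (if evenperm p = b then p else p \<circ> transpose 1 2)"
  have perm: "permutation r" if "r permutes {1..n}" for r
    using that by (rule permutes_imp_permutation[rotated]) simp
  have q: "q permutes {1..n}" "q (n - 2) = y" "q (n - 1) = x" "q n = c" "evenperm q = b"
    using p n evenperm_comp_transpose[OF perm[OF p(1)], of 1 2]
    by (auto simp: q_def transpose_def intro!: permutes_compose permutes_swap_id)
  define r where "r = q \<circ> bubble_swap (n - 2)"
  have n': "n - 2 + 1 = n - 1" using n by simp
  have "bubble_swap (n - 2) permutes {1..n}" using n by (intro permutes_swap_id) auto
  then have r: "r permutes {1..n}" "r (n - 1) = y" "r n = c" "evenperm r \<noteq> b"
    using q n evenperm_comp_transpose[OF perm[OF q(1)], of "n - 2" "n - 2 + 1"]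
    unfolding n' r_def by (auto simp: transpose_def intro!: permutes_compose)
  have "bstep n n q r" using n by (auto simp: bstep_def r_def intro!: bexI[of _ "n - 2"])
  moreover have "q \<in> pverts (bs_prism n i j)" "r \<in> pverts (bs_prism n k l)"
    using q r eq by (auto simp: pverts_bs_prism doubleton_eq_iff)
  ultimately show "\<exists>q\<in>pverts (bs_prism n i j). \<exists>r\<in>pverts (bs_prism n k l).
      evenperm q = b \<and> evenperm r \<noteq> b \<and> bstep n n q r"
    using q(5) r(4) by blast
qed

lemma disjnt_bs_prism:
  assumes "{i, j} \<noteq> {k, l}"
  shows "disjnt (pverts (bs_prism n i j)) (pverts (bs_prism n k l))"
  using assms by (auto simp: disjnt_def pverts_bs_prism doubleton_eq_iff)

lemma laceable_bs_prism:
  assumes "5 \<le> n" "i \<in> {1..n}" "j \<in> {1..n}" "i \<noteq> j"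
  shows "laceable (bstep n (n - 2)) evenperm (pverts (bs_prism n i j))"
proof -
  obtain p where p: "p permutes {1..n}" "p (n - 1) = i" "p n = j"
    using exists_permutes_two[OF assms(2-4)] by blast
  have "permutation p" using p(1) by (rule permutes_imp_permutation[rotated]) simp
  then have "laceable (bstep n (n - 2)) evenperm (bs_block n (n - 2) p)"
    using assms(1) by (intro laceable_bs_block) auto
  then show ?thesis using pverts_bs_prism_eq_block[of n p] assms(1) p by simp
qed

lemma Union_bs_prism_cover:
  assumes "2 \<le> n"
  shows "(\<Union>P\<in>bs_prism_cover n. pverts P) = pverts (bubble_sort_graph n)"
proof (intro equalityI subsetI)
  fix p assume "p \<in> pverts (bubble_sort_graph n)"
  then have p: "p permutes {1..n}" by (simp add: pverts_bubble_sort_graph)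
  have "n - 1 \<in> {1..n}" "n \<in> {1..n}" "n - 1 \<noteq> n" using assms by auto
  then have "p (n - 1) \<in> {1..n}" "p n \<in> {1..n}" "p (n - 1) \<noteq> p n"
    using permutes_in_image[OF p] inj_eq[OF permutes_inj[OF p]] by blast+
  then have "bs_prism n (p (n - 1)) (p n) \<in> bs_prism_cover n"
    unfolding bs_prism_cover_def by blast
  then show "p \<in> (\<Union>P\<in>bs_prism_cover n. pverts P)"
    using p by (intro UN_I) (auto simp: pverts_bs_prism)
qed (auto simp: bs_prism_cover_def pverts_bs_prism pverts_bubble_sort_graph)

lemma maximal_cover_bs_prism:
  assumes n: "5 \<le> n"
  shows "maximal_cover (bubble_sort_graph n) (generalized_prism (bubble_sort_graph (n - 2)))
    (bs_prism_cover n)"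
  unfolding maximal_cover_def
proof (intro conjI ballI)
  fix P assume "P \<in> bs_prism_cover n"
  then obtain i j where ij: "P = bs_prism n i j" "i \<in> {1..n}" "j \<in> {1..n}" "i \<noteq> j"
    unfolding bs_prism_cover_def by blast
  show "digraph_iso (with_proj P) (with_proj (generalized_prism (bubble_sort_graph (n - 2))))"
    unfolding ij(1) by (rule bs_prism_iso[OF n ij(2-4)])
  have "pverts P \<subseteq> pverts (bubble_sort_graph n)"
    by (auto simp: ij(1) pverts_bs_prism pverts_bubble_sort_graph)
  moreover have "parcs P \<subseteq> parcs (bubble_sort_graph n)"
  proof clarify
    fix p q assume "(p, q) \<in> parcs P"
    then have "p permutes {1..n}" "bstep n (n - 2) p q"
      using n by (simp_all add: ij(1) parcs_bs_prism pverts_bs_prism)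
    then show "(p, q) \<in> parcs (bubble_sort_graph n)"
      using n bstep_mono[of n "n - 2" p q n] by (simp add: parcs_bubble_sort_graph_bstep)
  qed
  ultimately show "subgraph (with_proj P) (with_proj (bubble_sort_graph n))"
    using n wf_bubble_sort_graph[of n] wf_bs_prism[of n i j]
    by (auto simp: subgraph_def ij(1))
next
  show "pairwise (\<lambda>P Q. disjnt (pverts P) (pverts Q)) (bs_prism_cover n)"
  proof (rule pairwiseI)
    fix P Q assume PQ: "P \<in> bs_prism_cover n" "Q \<in> bs_prism_cover n" "P \<noteq> Q"
    then obtain i j k l where ij: "P = bs_prism n i j" "Q = bs_prism n k l"
      unfolding bs_prism_cover_def by blast
    have "{i, j} \<noteq> {k, l}"
      using PQ(3) ij bs_prism_commute[of n k l] by (auto simp: doubleton_eq_iff)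
    then show "disjnt (pverts P) (pverts Q)" unfolding ij by (rule disjnt_bs_prism)
  qed
qed (use n in \<open>simp add: Union_bs_prism_cover\<close>)

lemma hamiltonian_cycle_bs_prism_cover:
  assumes n: "5 \<le> n"
  shows "\<exists>c. hamiltonian_cycle_based_on (bubble_sort_graph n) (bs_prism_cover n) c"
proof -
  let ?G = "bubble_sort_graph n"
  define V where "V e = pverts (bs_prism n (fst e) (snd e))" for e
  obtain L where L: "L \<noteq> []" "distinct L" "set L = {(i, j). 1 \<le> i \<and> i < j \<and> j \<le> n}"
    "successively adjacent_pairs L" "hd L = (1, n)" "last L = (n - 1, n)"
    using exists_pair_list[of 1 n] n by auto
  have mem: "fst e \<in> {1..n} \<and> snd e \<in> {1..n} \<and> fst e \<noteq> snd e" if "e \<in> set L" for e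
    using that unfolding L(3) by auto
  have doubleton: "{fst e, snd e} \<noteq> {fst f, snd f}" if "e \<in> set L" "f \<in> set L" "e \<noteq> f" for e f
    using that unfolding L(3) by (auto simp: doubleton_eq_iff)
  have disj: "disjnt (V e) (V f)" if "e \<in> set L" "f \<in> set L" "e \<noteq> f" for e f
    unfolding V_def by (rule disjnt_bs_prism[OF doubleton[OF that]])
  have link: "linked (bstep n n) evenperm (V e) (V f)" if "e \<in> set L" "f \<in> set L" "adjacent_pairs e f" for e f
    unfolding V_def using mem[OF that(1)] mem[OF that(2)] doubleton[OF that(1,2)] that(3)
    by (intro linked_bs_prism[OF n]) (simp_all only: adjacent_pairs_def not_False_eq_True)
  \<comment> \<open>The closing edge is chosen first: the last pair \<open>(n - 1, n)\<close> and
    the first pair \<open>(1, n)\<close> share \<open>n\<close>. Its ends \<open>v\<close> and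
    \<open>u\<close> have opposite parity and are then prescribed as the ends of the Hamiltonian
    path.\<close>
  have "linked (bstep n n) evenperm (V (last L)) (V (hd L))"
    using n L(5,6) last_in_set[OF L(1)] hd_in_set[OF L(1)] by (intro link) (simp_all add: adjacent_pairs_def)
  then obtain u v where uv: "v \<in> V (last L)" "u \<in> V (hd L)" "evenperm u \<noteq> evenperm v" "bstep n n v u"
    unfolding linked_def by metis
  have "\<exists>xss. list_all2 (hpath (bstep n (n - 2))) (map V L) xss \<and>
      hpath (bstep n n) (\<Union>(set (map V L))) (concat xss) \<and> hd (concat xss) = u \<and> last (concat xss) = v"
  proof (rule laceable_chain)
    show "laceable (bstep n (n - 2)) evenperm B" if "B \<in> set (map V L)" for B
      using that mem laceable_bs_prism[OF n] by (auto simp: V_def)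
    have "sorted_wrt (\<lambda>e f. disjnt (V e) (V f)) L"
      using L(2) disj by (induction L) auto
    then show "sorted_wrt disjnt (map V L)" by (simp add: sorted_wrt_map)
    show "successively (linked (bstep n n) evenperm) (map V L)"
      unfolding successively_map using L(4) by (rule successively_mono) (rule link)
    show "bstep n n x y" if "bstep n (n - 2) x y" for x y
      using that by (rule bstep_mono) simp
  qed (use L(1) uv in \<open>auto simp: hd_map last_map\<close>)
  then obtain xss where xss: "list_all2 (hpath (bstep n (n - 2))) (map V L) xss"
    "hpath (bstep n n) (\<Union>(set (map V L))) (concat xss)" "hd (concat xss) = u" "last (concat xss) = v"
    by blast
  \<comment> \<open>\<open>L\<close> lists only pairs with increasing components; the other order is
    covered by the symmetry of \<open>bs_prism\<close>.\<close>
  have prism: "\<exists>e\<in>set L. P = bs_prism n (fst e) (snd e)" if "P \<in> bs_prism_cover n" for P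
  proof -
    obtain i j where ij: "P = bs_prism n i j" "i \<in> {1..n}" "j \<in> {1..n}" "i \<noteq> j"
      using \<open>P \<in> bs_prism_cover n\<close> unfolding bs_prism_cover_def by blast
    show ?thesis
    proof (cases "i < j")
      case True
      then have "(i, j) \<in> set L" using ij unfolding L(3) by auto
      then show ?thesis unfolding ij(1) by force
    next
      case False
      then have "(j, i) \<in> set L" using ij unfolding L(3) by auto
      then show ?thesis unfolding ij(1) bs_prism_commute[of n i] by force
    qed
  qed
  have "(\<Union>(set (map V L))) = pverts ?G"
  proof -
    have "bs_prism n (fst e) (snd e) \<in> bs_prism_cover n" if "e \<in> set L" for e
      using mem[OF that] unfolding bs_prism_cover_def by blast
    then have "(\<Union>(set (map V L))) = (\<Union>P\<in>bs_prism_cover n. pverts P)"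
      using prism by (fastforce simp: V_def)
    then show ?thesis using Union_bs_prism_cover[of n] n by simp
  qed
  then have path: "hpath (bstep n n) (pverts ?G) (concat xss)" using xss(2) by simp
  show ?thesis
  proof (rule exI, rule hamiltonian_cycle_based_on_concat[where xss = xss])
    show "hpath (\<lambda>x y. (x, y) \<in> parcs ?G) (pverts ?G) (concat xss)"
      using n by (intro hpath_mono[OF hpath_restrict[OF path]])
        (simp add: parcs_bubble_sort_graph_bstep pverts_bubble_sort_graph)
    show "(last (concat xss), hd (concat xss)) \<in> parcs ?G"
      using uv xss(3,4) n by (simp add: parcs_bubble_sort_graph_bstep V_def pverts_bs_prism)
    have "length (concat xss) = card (pverts ?G)"
      using path distinct_card unfolding hpath_def by metis
    also have "\<dots> = fact n"
      unfolding pverts_bubble_sort_graph by (rule card_permutations) auto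
    finally show "3 \<le> length (concat xss)"
      using fact_ge_self[of n] n by linarith
    fix P assume "P \<in> bs_prism_cover n"
    then obtain e where e: "e \<in> set L" "P = bs_prism n (fst e) (snd e)" using prism by blast
    \<comment> \<open>The piece of \<open>xss\<close> at index \<open>m\<close> is the path through
      the prism of the pair at index \<open>m\<close> of \<open>L\<close>.\<close>
    then obtain m where m: "m < length L" "L ! m = e" by (auto simp: in_set_conv_nth)
    then have "hpath (bstep n (n - 2)) (V e) (xss ! m)" "xss ! m \<in> set xss"
      using list_all2_nthD[OF xss(1), of m] list_all2_lengthD[OF xss(1)] by auto
    then have "hpath (\<lambda>x y. (x, y) \<in> parcs P) (pverts P) (xss ! m)"
      using hpath_restrict[of "bstep n (n - 2)" "V e"] n by (simp add: e(2) V_def parcs_bs_prism)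
    then show "\<exists>xs\<in>set xss. hpath (\<lambda>x y. (x, y) \<in> parcs P) (pverts P) xs"
      using \<open>xss ! m \<in> set xss\<close> by blast
  qed
qed

theorem theorem3:
  fixes n :: nat
  assumes "n \<ge> 5"
  shows "(\<forall>i\<in>{1..n}. \<forall>j\<in>{1..n}. i \<noteq> j \<longrightarrow>
            digraph_iso (with_proj (bs_prism n i j))
              (with_proj (generalized_prism (bubble_sort_graph (n - 2))))) \<and>
         maximal_cover (bubble_sort_graph n) (generalized_prism (bubble_sort_graph (n - 2)))
           (bs_prism_cover n) \<and>
         (\<exists>c. hamiltonian_cycle_based_on (bubble_sort_graph n) (bs_prism_cover n) c)"
  using bs_prism_iso[OF assms] maximal_cover_bs_prism[OF assms]
    hamiltonian_cycle_bs_prism_cover[OF assms]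
  by blast

end
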